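(* Let $G$ be a Lie group acting differentiably on a manifold $M$ (action written $g\cdot m$), and let $\alpha: M\to G$ be a differentiable map. Define $J_\alpha: M\to M$ by $J_\alpha(m)=\alpha(m)\cdot m$. Suppose that $\alpha$ is $G$-equivariant with respect to the conjugation action of $G$ on itself, i.e. $\alpha(g\cdot m)=g\,\alpha(m)\,g^{-1}$ for all $g\in G$ and $m\in M$. Then $J_\alpha$ is a bijection whose inverse is $(J_\alpha)^{-1}=J_{\alpha^{-1}}$, and for every positive integer $n$ the $n$-fold composition satisfies $(J_\alpha)^n=J_\alpha\circ\dots\circ J_\alpha=J_{\alpha^n}$.
   Context: All groups, actions and maps are in the differentiable category. For a map $\alpha: M\to G$, the maps $\alpha^{-1}$ and $\alpha^n$ from $M$ to $G$ denote pointwise inverse and pointwise power in the group: $\alpha^{-1}(m)=(\alpha(m))^{-1}$ and $\alpha^n(m)=(\alpha(m))^n$. For any differentiable map $\beta: M\to G$, $J_\beta: M\to M$ is the map $J_\beta(m)=\beta(m)\cdot m$ (the "J-process" self-map of $M$ associated to $\beta$). *)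

theory Defs
  imports "HOL-Analysis.Analysis" "HOL-Algebra.Group_Action"
begin

section \<open>Smooth maps between normed spaces\<close>

(* Intended for open S. For a finite-dimensional domain, continuity of x |-> Df(x) is
   equivalent to continuity of x |-> Df(x) v for every fixed vector v, so quantifying over
   directions v yields the usual class C^k. *)
primrec Ck_on :: "nat \<Rightarrow> 'a::real_normed_vector set \<Rightarrow> ('a \<Rightarrow> 'b::real_normed_vector) \<Rightarrow> bool" where
  "Ck_on 0 S f \<longleftrightarrow> continuous_on S f"
| "Ck_on (Suc k) S f \<longleftrightarrow>
     (\<forall>x\<in>S. f differentiable (at x)) \<and>
     (\<forall>v. Ck_on k S (\<lambda>x. frechet_derivative f (at x) v))"

definition smooth_on :: "'a::real_normed_vector set \<Rightarrow> ('a \<Rightarrow> 'b::real_normed_vector) \<Rightarrow> bool" where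
  "smooth_on S f \<longleftrightarrow> (\<forall>k. Ck_on k S f)"

section \<open>Smooth manifolds\<close>

(* A chart is a pair (U, phi) of its domain and its coordinate map; phi is relevant on U only.
   The model space 'e is a normed space that smooth_manifold below requires to be
   finite-dimensional. The class euclidean_space is not used because it excludes dimension 0,
   hence discrete groups. *)
type_synonym ('m, 'e) atlas = "('m set \<times> ('m \<Rightarrow> 'e)) set"

definition chart :: "'m topology \<Rightarrow> 'm set \<times> ('m \<Rightarrow> 'e::real_normed_vector) \<Rightarrow> bool" where
  "chart X = (\<lambda>(U, \<phi>). openin X U \<and> open (\<phi> ` U) \<and>
     homeomorphic_map (subtopology X U) (top_of_set (\<phi> ` U)) \<phi>)"

definition smooth_transition ::
  "'m set \<times> ('m \<Rightarrow> 'e::real_normed_vector) \<Rightarrow> 'm set \<times> ('m \<Rightarrow> 'e) \<Rightarrow> bool" where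
  "smooth_transition = (\<lambda>(U, \<phi>) (V, \<psi>). smooth_on (\<phi> ` (U \<inter> V)) (\<psi> \<circ> inv_into U \<phi>))"

(* The smooth structure is given by an atlas that need not be maximal; smoothness of maps
   does not change when the atlas is enlarged to the maximal one. *)
definition smooth_manifold :: "'m topology \<Rightarrow> ('m, 'e::real_normed_vector) atlas \<Rightarrow> bool" where
  "smooth_manifold X A \<longleftrightarrow>
     (\<exists>B :: 'e set. finite B \<and> span B = UNIV) \<and>
     Hausdorff_space X \<and> second_countable X \<and>
     (\<forall>c\<in>A. chart X c) \<and> (\<Union>c\<in>A. fst c) = topspace X \<and>
     (\<forall>c\<in>A. \<forall>d\<in>A. smooth_transition c d)"

definition smooth_map ::
  "'m topology \<Rightarrow> ('m, 'e::real_normed_vector) atlas \<Rightarrow>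
   'n topology \<Rightarrow> ('n, 'f::real_normed_vector) atlas \<Rightarrow> ('m \<Rightarrow> 'n) \<Rightarrow> bool" where
  "smooth_map X A Y B f \<longleftrightarrow> continuous_map X Y f \<and>
     (\<forall>(U, \<phi>)\<in>A. \<forall>(V, \<psi>)\<in>B. smooth_on (\<phi> ` (U \<inter> f -` V)) (\<psi> \<circ> f \<circ> inv_into U \<phi>))"

definition prod_atlas ::
  "('m, 'e) atlas \<Rightarrow> ('n, 'f) atlas \<Rightarrow> ('m \<times> 'n, 'e \<times> 'f) atlas" where
  "prod_atlas A B = {(U \<times> V, map_prod \<phi> \<psi>) | U \<phi> V \<psi>. (U, \<phi>) \<in> A \<and> (V, \<psi>) \<in> B}"

section \<open>Lie groups and their actions\<close>

definition lie_group ::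
  "('g, 'z) monoid_scheme \<Rightarrow> 'g topology \<Rightarrow> ('g, 'e::real_normed_vector) atlas \<Rightarrow> bool" where
  "lie_group G X A \<longleftrightarrow>
     group G \<and> topspace X = carrier G \<and> smooth_manifold X A \<and>
     smooth_map (prod_topology X X) (prod_atlas A A) X A (\<lambda>(g, h). g \<otimes>\<^bsub>G\<^esub> h) \<and>
     smooth_map X A X A (\<lambda>g. inv\<^bsub>G\<^esub> g)"

definition smooth_action ::
  "('g, 'z) monoid_scheme \<Rightarrow> 'g topology \<Rightarrow> ('g, 'e::real_normed_vector) atlas \<Rightarrow>
   'm topology \<Rightarrow> ('m, 'f::real_normed_vector) atlas \<Rightarrow> ('g \<Rightarrow> 'm \<Rightarrow> 'm) \<Rightarrow> bool" where
  "smooth_action G X A Y B act \<longleftrightarrow>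
     group_action G (topspace Y) act \<and>
     smooth_map (prod_topology X Y) (prod_atlas A B) Y B (\<lambda>(g, m). act g m)"

definition J_map :: "('g \<Rightarrow> 'm \<Rightarrow> 'm) \<Rightarrow> ('m \<Rightarrow> 'g) \<Rightarrow> 'm \<Rightarrow> 'm" where
  "J_map act \<beta> m = act (\<beta> m) m"

end

theory Submission
  imports Defs
begin

text \<open>
  Equivariance makes \<open>\<alpha>\<close> invariant along its own action: conjugating a group element by itself, or by
  its inverse, does nothing. So iterating the process keeps acting by powers of one fixed element.
\<close>

text \<open>The algebraic core of the theorem, with \<open>E\<close> as the point set of the
  manifold. \<open>closed\<close> is explicit because \<alpha> is a total function on a
  type.\<close>

locale conj_equivariant = group_action +
  fixes \<alpha> :: "'c \<Rightarrow> 'a"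
  assumes closed [simp, intro]: "m \<in> E \<Longrightarrow> \<alpha> m \<in> carrier G"
    and equivariant: "g \<in> carrier G \<Longrightarrow> m \<in> E \<Longrightarrow> \<alpha> (\<phi> g m) = g \<otimes> \<alpha> m \<otimes> inv g"
begin

sublocale G: group G
  using group_hom by (rule group_hom.axioms)

lemma J_map_closed: "m \<in> E \<Longrightarrow> J_map \<phi> \<alpha> m \<in> E"
  unfolding J_map_def by (rule element_image) auto

lemma J_map_inv_closed: "m \<in> E \<Longrightarrow> J_map \<phi> (\<lambda>x. inv (\<alpha> x)) m \<in> E"
  unfolding J_map_def by (rule element_image) auto

lemma invariant: "m \<in> E \<Longrightarrow> \<alpha> (J_map \<phi> \<alpha> m) = \<alpha> m"
  unfolding J_map_def by (simp add: equivariant G.m_assoc)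

lemma invariant_inv: "m \<in> E \<Longrightarrow> \<alpha> (J_map \<phi> (\<lambda>x. inv (\<alpha> x)) m) = \<alpha> m"
  unfolding J_map_def by (simp add: equivariant)

text \<open>By \<open>invariant\<close>, the outer map acts by the inverse of the very element
  \<open>\<alpha> m\<close> that the inner map used, so the two actions cancel.\<close>

lemma J_map_inv_left: "m \<in> E \<Longrightarrow> J_map \<phi> (\<lambda>x. inv (\<alpha> x)) (J_map \<phi> \<alpha> m) = m"
  using invariant [of m] orbit_sym_aux [of "\<alpha> m" m] by (simp add: J_map_def)

lemma J_map_inv_right: "m \<in> E \<Longrightarrow> J_map \<phi> \<alpha> (J_map \<phi> (\<lambda>x. inv (\<alpha> x)) m) = m"
  using invariant_inv [of m] orbit_sym_aux [of "inv (\<alpha> m)" m] by (simp add: J_map_def)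

lemma J_map_bij_betw: "bij_betw (J_map \<phi> \<alpha>) E E"
  by (rule bij_betw_byWitness [where f' = "J_map \<phi> (\<lambda>x. inv (\<alpha> x))"])
    (auto simp: J_map_inv_left J_map_inv_right J_map_closed J_map_inv_closed)

lemma inv_into_J_map:
  assumes "m \<in> E"
  shows "inv_into E (J_map \<phi> \<alpha>) m = J_map \<phi> (\<lambda>x. inv (\<alpha> x)) m"
  using J_map_bij_betw assms
  \<comment> \<open>By injectivity, any preimage of \<open>m\<close> in \<open>E\<close> is the
    value of \<open>inv_into\<close>; the right inverse law supplies one.\<close>
  by (intro inv_into_f_eq) (auto simp: bij_betw_def J_map_inv_right J_map_inv_closed)

lemma J_map_funpow:
  assumes "m \<in> E"
  shows "(J_map \<phi> \<alpha> ^^ n) m = J_map \<phi> (\<lambda>x. \<alpha> x [^] n) m"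
  using assms
\<comment> \<open>The point must vary: the induction hypothesis is applied at
  \<open>J_map \<phi> \<alpha> m\<close>.\<close>
proof (induction n arbitrary: m)
  case 0
  \<comment> \<open>The unit acts as the identity restricted to \<open>E\<close>, so
    \<open>m \<in> E\<close> matters here.\<close>
  have "\<phi> \<one> m = m"
    using id_eq_one 0 by (metis restrict_apply')
  then show ?case
    by (simp add: J_map_def)
next
  case (Suc n)
  \<comment> \<open>The innermost application is split off, so that invariance can replace \<alpha>
    at the image point by \<open>\<alpha> m\<close>.\<close>
  have "(J_map \<phi> \<alpha> ^^ Suc n) m = J_map \<phi> (\<lambda>x. \<alpha> x [^] n) (J_map \<phi> \<alpha> m)"
    using Suc by (simp add: J_map_closed funpow_Suc_right del: funpow.simps)
  \<comment> \<open>Successive actions multiply, and \<open>\<alpha> m [^] Suc n\<close> unfolds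
    with the extra factor on the right, matching the action performed first.\<close>
  also have "\<dots> = \<phi> (\<alpha> m [^] n) (\<phi> (\<alpha> m) m)"
    using invariant [OF Suc.prems] by (simp add: J_map_def)
  also have "\<dots> = J_map \<phi> (\<lambda>x. \<alpha> x [^] Suc n) m"
    using Suc.prems by (simp add: J_map_def composition_rule)
  finally show ?case .
qed

end

theorem theorem2p1:
  fixes G :: "('g, 'z) monoid_scheme"
    and XG :: "'g topology" and AG :: "('g, 'e::real_normed_vector) atlas"
    and XM :: "'m topology" and AM :: "('m, 'f::real_normed_vector) atlas"
    and act :: "'g \<Rightarrow> 'm \<Rightarrow> 'm" and \<alpha> :: "'m \<Rightarrow> 'g"
  defines "M \<equiv> topspace XM"
  assumes "lie_group G XG AG"
    and "smooth_manifold XM AM"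
    and "smooth_action G XG AG XM AM act"
    and "smooth_map XM AM XG AG \<alpha>"
    and "\<forall>g\<in>carrier G. \<forall>m\<in>M. \<alpha> (act g m) = g \<otimes>\<^bsub>G\<^esub> \<alpha> m \<otimes>\<^bsub>G\<^esub> inv\<^bsub>G\<^esub> g"
  shows "bij_betw (J_map act \<alpha>) M M \<and>
    (\<forall>m\<in>M. inv_into M (J_map act \<alpha>) m = J_map act (\<lambda>x. inv\<^bsub>G\<^esub> (\<alpha> x)) m) \<and>
    (\<forall>n::nat. n > 0 \<longrightarrow>
       (\<forall>m\<in>M. (J_map act \<alpha> ^^ n) m = J_map act (\<lambda>x. \<alpha> x [^]\<^bsub>G\<^esub> n) m))"
proof -
  have "topspace XG = carrier G"
    using assms(2) by (simp add: lie_group_def)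
  moreover have "group_action G M act"
    using assms(4) by (simp add: smooth_action_def M_def)
  \<comment> \<open>Continuity includes mapping points into the group, which yields
    \<open>closed\<close>.\<close>
  moreover have "\<alpha> \<in> topspace XM \<rightarrow> topspace XG"
    using assms(5) by (simp add: smooth_map_def continuous_map_funspace)
  ultimately interpret conj_equivariant G M act \<alpha>
    using assms(6)
    by (intro conj_equivariant.intro conj_equivariant_axioms.intro) (auto simp: M_def)
  show ?thesis
    using J_map_bij_betw inv_into_J_map J_map_funpow by blast
qed

end
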